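(* Let $n\ge 3$ be an integer. If $n\equiv 0\pmod 4$, then $P(n,1)$ is an Italian graph; if $n\not\equiv 0\pmod 4$, then $P(n,1)$ is not an Italian graph.
   Context: $P(n,k)$ (with $n\ge 3$, $1\le k<n/2$) denotes the generalized Petersen graph: the 3-regular simple graph on the $2n$ vertices $v_0,v_1,\dots,v_{2n-1}$ (subscripts read modulo $2n$) with edges $v_{2i}v_{2i+2}$, $v_{2i}v_{2i+1}$ and $v_{2i+1}v_{2i+1+2k}$ for $0\le i\le n-1$. For a graph $G=(V,E)$, an Italian dominating function (IDF) of $G$ is a function $f:V\to\{0,1,2\}$ such that every $v\in V$ with $f(v)=0$ satisfies $\sum_{u\in N(v)}f(u)\ge 2$, where $N(v)$ is the open neighborhood of $v$. Its weight is $w(f)=\sum_{v\in V}f(v)$, and the Italian domination number is $\gamma_I(G)=\min_f w(f)$ over all IDFs $f$ of $G$. The domination number $\gamma(G)$ is the minimum cardinality of a set $D\subseteq V$ such that every vertex of $G$ is in $D$ or adjacent to a vertex of $D$. A graph $G$ is called an Italian graph if $\gamma_I(G)=2\gamma(G)$. *)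

theory Defs
  imports "Graph_Theory.Pair_Digraph"
begin

text \<open>
  A finite simple graph is a \<^locale>\<open>pair_graph\<close>: an edge between u and v is
  represented by the two arcs (u,v) and (v,u).
\<close>

definition open_nbhd :: "'a pair_pre_digraph \<Rightarrow> 'a \<Rightarrow> 'a set" where
  "open_nbhd G v = {u. v \<rightarrow>\<^bsub>G\<^esub> u}"

text \<open>Only the values of f on the vertices of G are relevant.\<close>

definition italian_dominating :: "'a pair_pre_digraph \<Rightarrow> ('a \<Rightarrow> nat) \<Rightarrow> bool" where
  "italian_dominating G f \<longleftrightarrow>
     f ` pverts G \<subseteq> {0, 1, 2} \<and>
     (\<forall>v\<in>pverts G. f v = 0 \<longrightarrow> (\<Sum>u\<in>open_nbhd G v. f u) \<ge> 2)"

definition weight :: "'a pair_pre_digraph \<Rightarrow> ('a \<Rightarrow> nat) \<Rightarrow> nat" where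
  "weight G f = (\<Sum>v\<in>pverts G. f v)"

definition italian_domination_number :: "'a pair_pre_digraph \<Rightarrow> nat" where
  "italian_domination_number G = (LEAST w. \<exists>f. italian_dominating G f \<and> weight G f = w)"

definition dominating :: "'a pair_pre_digraph \<Rightarrow> 'a set \<Rightarrow> bool" where
  "dominating G D \<longleftrightarrow>
     D \<subseteq> pverts G \<and> (\<forall>v\<in>pverts G. v \<in> D \<or> (\<exists>u\<in>D. v \<rightarrow>\<^bsub>G\<^esub> u))"

definition domination_number :: "'a pair_pre_digraph \<Rightarrow> nat" where
  "domination_number G = (LEAST k. \<exists>D. dominating G D \<and> card D = k)"

definition italian_graph :: "'a pair_pre_digraph \<Rightarrow> bool" where
  "italian_graph G \<longleftrightarrow> italian_domination_number G = 2 * domination_number G"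

text \<open>
  The minima above are taken over nonempty sets: the constant function 2 is Italian
  dominating and the set of all vertices is dominating.
\<close>

lemma italian_domination_number_attained:
  "\<exists>f. italian_dominating G f \<and> weight G f = italian_domination_number G"
proof -
  have "italian_dominating G (\<lambda>_. 2)" by (auto simp: italian_dominating_def)
  then have "\<exists>w f. italian_dominating G f \<and> weight G f = w" by blast
  then show ?thesis unfolding italian_domination_number_def by (rule LeastI_ex)
qed

lemma domination_number_attained:
  "\<exists>D. dominating G D \<and> card D = domination_number G"
proof -
  have "dominating G (pverts G)" by (auto simp: dominating_def)
  then have "\<exists>k D. dominating G D \<and> card D = k" by blast
  then show ?thesis unfolding domination_number_def by (rule LeastI_ex)
qed

text \<open>
  The vertex $v_j$ is represented by its subscript j, reduced modulo 2n. The generalized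
  Petersen graph P(n,k) is only meaningful for n \<ge> 3 and 1 \<le> k < n/2.
\<close>

definition petersen_edges :: "nat \<Rightarrow> nat \<Rightarrow> (nat \<times> nat) set" where
  "petersen_edges n k =
     (\<Union>i\<in>{0..<n}. {(2*i, (2*i + 2) mod (2*n)),
                    (2*i, 2*i + 1),
                    (2*i + 1, (2*i + 1 + 2*k) mod (2*n))})"

definition petersen :: "nat \<Rightarrow> nat \<Rightarrow> nat pair_pre_digraph" where
  "petersen n k =
     \<lparr> pverts = {0..<2*n}, parcs = petersen_edges n k \<union> (petersen_edges n k)\<inverse> \<rparr>"

lemma mod_add_neq_self:
  fixes a b m :: nat
  assumes "0 < b" "b < m" "a < m"
  shows "(a + b) mod m \<noteq> a"
proof (cases "a + b < m")
  case False
  then have "(a + b) mod m = a + b - m"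
    using assms by (simp add: le_mod_geq)
  then show ?thesis using assms False by linarith
qed (use assms in simp)

lemma pair_graph_petersen:
  assumes "n \<ge> 3" "1 \<le> k" "2 * k < n"
  shows "pair_graph (petersen n k)"
proof -
  have *: "u < 2*n \<and> v < 2*n \<and> u \<noteq> v" if "(u, v) \<in> petersen_edges n k" for u v
  proof -
    from that obtain i where i: "i < n"
      and uv: "(u, v) \<in> {(2*i, (2*i + 2) mod (2*n)), (2*i, 2*i + 1),
                          (2*i + 1, (2*i + 1 + 2*k) mod (2*n))}"
      by (auto simp: petersen_edges_def)
    have "(2*i + 2) mod (2*n) \<noteq> 2*i"
      using i assms by (intro mod_add_neq_self) auto
    moreover have "(2*i + 1 + 2*k) mod (2*n) \<noteq> 2*i + 1"
      using i assms by (intro mod_add_neq_self) auto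
    moreover have "x mod (2*n) < 2*n" for x
      using assms by simp
    ultimately show ?thesis using uv i
      by (elim insertE emptyE) auto
  qed
  have fin: "finite (petersen_edges n k)" by (simp add: petersen_edges_def)
  show ?thesis
    by unfold_locales
      (use * fin in \<open>fastforce simp: petersen_def symmetric_def intro: symI\<close>)+
qed

end

theory Submission
  imports Defs
begin

text \<open>
  The graph \<open>P(n,1)\<close> is the prism over an \<open>n\<close>-cycle: \<open>n\<close> columns of two adjacent vertices
  \<open>2 * i\<close> and \<open>2 * i + 1\<close>, consecutive columns being joined along both rows. The proof compares
  three numbers: \<open>n\<close>, \<open>\<gamma>\<^sub>I\<close> and \<open>2 * \<gamma>\<close>.

  One has \<open>\<gamma>\<^sub>I = n\<close> for every \<open>n\<close>. Weight \<open>n\<close> is reached by putting a single 1 in each column,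
  in alternating rows (\<open>italian_dominating_zigzag\<close>). No smaller weight is possible
  (\<open>weight_ge_columns\<close>), by a discharging argument on the column sums: a column of weight 0 has
  neighbouring columns of total weight at least 4, whose excess over 1 can pay for it.

  If 4 divides \<open>n\<close>, then taking one vertex from every second column, in alternating rows, gives a
  dominating set of \<open>n div 2\<close> vertices, so \<open>2 * \<gamma> \<le> n \<le> \<gamma>\<^sub>I\<close>, and \<open>\<gamma>\<^sub>I \<le> 2 * \<gamma>\<close> holds in every graph.

  Conversely, let \<open>\<gamma>\<^sub>I = 2 * \<gamma>\<close>; then \<open>2 * \<gamma> \<le> n\<close>. Closed neighbourhoods have 4 vertices and there
  are \<open>2 * n\<close> vertices, so a minimum dominating set dominates every vertex exactly once
  (\<open>perfect_if_small\<close>). This forces the pattern: a chosen vertex in column \<open>i\<close> entails a chosen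
  vertex in column \<open>i + 2\<close> in the other row (\<open>perfect_step\<close>). Since no column contains two chosen
  vertices, going round the cycle must take an even number of such steps, whence 4 divides \<open>n\<close>.
\<close>

section \<open>Doubling a dominating set\<close>

text \<open>The value 2 on a dominating set and 0 elsewhere is Italian dominating.\<close>

lemma italian_domination_number_le_double:
  assumes "pair_graph G"
  shows "italian_domination_number G \<le> 2 * domination_number G"
proof -
  interpret pair_graph G by fact
  obtain D where D: "dominating G D" "card D = domination_number G"
    using domination_number_attained by blast
  define f :: "'a \<Rightarrow> nat" where "f v = (if v \<in> D then 2 else 0)" for v
  have sub: "D \<subseteq> pverts G" using D by (simp add: dominating_def)
  have "(\<Sum>u\<in>open_nbhd G v. f u) \<ge> 2" if v: "v \<in> pverts G" "f v = 0" for v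
  proof -
    obtain u where u: "u \<in> D" "v \<rightarrow>\<^bsub>G\<^esub> u"
      using v D by (auto simp: dominating_def f_def split: if_splits)
    have "open_nbhd G v \<subseteq> pverts G" using arc_snd_in_verts by (fastforce simp: open_nbhd_def)
    then have "finite (open_nbhd G v)" by (rule finite_subset) simp
    moreover have "u \<in> open_nbhd G v" using u by (simp add: open_nbhd_def)
    ultimately have "f u \<le> (\<Sum>u\<in>open_nbhd G v. f u)" by (intro member_le_sum) auto
    then show ?thesis using u by (simp add: f_def)
  qed
  then have "italian_dominating G f" by (auto simp: italian_dominating_def f_def)
  moreover have "weight G f = 2 * card D"
    using sub by (simp add: weight_def f_def sum.If_cases Int_absorb1)
  ultimately show ?thesis
    unfolding italian_domination_number_def D(2)[symmetric] by (intro Least_le) blast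
qed

section \<open>The prism as a cycle of columns\<close>

definition cyc_suc :: "nat \<Rightarrow> nat \<Rightarrow> nat" where
  "cyc_suc n i = (i + 1) mod n"

definition cyc_pred :: "nat \<Rightarrow> nat \<Rightarrow> nat" where
  "cyc_pred n i = (i + n - 1) mod n"

lemma cyc_suc_if: "i < n \<Longrightarrow> cyc_suc n i = (if i + 1 = n then 0 else i + 1)"
  by (auto simp: cyc_suc_def)

lemma cyc_pred_if: "i < n \<Longrightarrow> cyc_pred n i = (if i = 0 then n - 1 else i - 1)"
  by (auto simp: cyc_pred_def mod_if)

lemma cyc_suc_less: "i < n \<Longrightarrow> cyc_suc n i < n"
  by (simp add: cyc_suc_def)

lemma cyc_pred_less: "i < n \<Longrightarrow> cyc_pred n i < n"
  by (simp add: cyc_pred_def)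

lemma cyc_pred_suc: "i < n \<Longrightarrow> cyc_pred n (cyc_suc n i) = i"
  by (auto simp: cyc_suc_if cyc_pred_if cyc_suc_less)

lemma cyc_suc_pred: "i < n \<Longrightarrow> cyc_suc n (cyc_pred n i) = i"
  by (auto simp: cyc_suc_if cyc_pred_if cyc_pred_less)

lemma sum_cyc_suc: "(\<Sum>i<n. F (cyc_suc n i)) = (\<Sum>i<n. F i)"
  by (rule sum.reindex_bij_witness[of _ "cyc_pred n" "cyc_suc n"])
     (auto simp: cyc_pred_suc cyc_suc_pred cyc_suc_less cyc_pred_less)

lemma sum_cyc_pred: "(\<Sum>i<n. F (cyc_pred n i)) = (\<Sum>i<n. F i)"
  by (rule sum.reindex_bij_witness[of _ "cyc_suc n" "cyc_pred n"])
     (auto simp: cyc_pred_suc cyc_suc_pred cyc_suc_less cyc_pred_less)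

lemma sum_by_columns: "(\<Sum>v\<in>{0..<2*n}. f v) = (\<Sum>i<n. f (2*i) + f (2*i+1))"
  for f :: "nat \<Rightarrow> nat"
  by (induction n) auto

lemma all_by_columns:
  "(\<forall>v\<in>{0..<2*n}. P v) \<longleftrightarrow> (\<forall>i<n. \<forall>r<2. P (2*i+r))" for n :: nat
proof (intro iffI ballI)
  fix v assume "\<forall>i<n. \<forall>r<2. P (2*i+r)" "v \<in> {0..<2*n}"
  moreover from this have "v div 2 < n" by auto
  moreover have "v mod 2 < 2" by simp
  ultimately have "P (2 * (v div 2) + v mod 2)" by blast
  then show "P v" by simp
qed auto

lemma column_row_eq_iff: "r < 2 \<Longrightarrow> t < 2 \<Longrightarrow> 2*i+r = 2*k+t \<longleftrightarrow> i = k \<and> r = t" for r :: nat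
  by arith

lemma petersen_edges_prism:
  "(v, u) \<in> petersen_edges n 1 \<longleftrightarrow>
     (\<exists>j<n. \<exists>s<2. v = 2*j+s \<and> (u = 2 * cyc_suc n j + s \<or> s = 0 \<and> u = 2*j+1))"
proof -
  have 1: "(2*j + 2) mod (2*n) = 2 * cyc_suc n j" for j
    using mult_mod_right[of 2 "j + 1" n] by (simp add: cyc_suc_def)
  have 2: "(2*j + 1 + 2*1) mod (2*n) = 2 * cyc_suc n j + 1" if "j < n" for j
  proof (cases "j + 1 = n")
    case True
    then have "2*j + 1 + 2*1 = 1 + 2*n" by simp
    then have "(2*j + 1 + 2*1) mod (2*n) = 1 mod (2*n)" by (simp only: mod_add_self2)
    then show ?thesis using True that by (simp add: cyc_suc_if)
  qed (use that in \<open>simp add: cyc_suc_if\<close>)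
  have rows: "(\<exists>s<2. P s) \<longleftrightarrow> P 0 \<or> P 1" for P :: "nat \<Rightarrow> bool"
    by (auto simp: less_2_cases_iff)
  have "petersen_edges n 1 =
      (\<Union>j\<in>{0..<n}. {(2*j, 2 * cyc_suc n j), (2*j, 2*j+1), (2*j+1, 2 * cyc_suc n j + 1)})"
    unfolding petersen_edges_def by (intro SUP_cong refl) (simp only: atLeastLessThan_iff 1 2)
  then show ?thesis unfolding rows by auto
qed

lemma open_nbhd_prism:
  assumes "n \<ge> 3" "i < n" "r < 2"
  shows "open_nbhd (petersen n 1) (2*i+r) =
         {2 * cyc_suc n i + r, 2 * cyc_pred n i + r, 2*i + (1-r)}"
proof -
  have "(2*i+r, u) \<in> petersen_edges n 1 \<longleftrightarrow> u = 2 * cyc_suc n i + r \<or> r = 0 \<and> u = 2*i+1" for u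
    unfolding petersen_edges_prism
    by (simp add: column_row_eq_iff assms cong: conj_cong)
  moreover have "(u, 2*i+r) \<in> petersen_edges n 1 \<longleftrightarrow>
      u = 2 * cyc_pred n i + r \<or> r = 1 \<and> u = 2*i" for u
  proof -
    have "i = cyc_suc n j \<longleftrightarrow> j = cyc_pred n i" if "j < n" for j
      using that assms cyc_pred_suc cyc_suc_pred by auto
    moreover have "2*i+r = 2*j+1 \<longleftrightarrow> i = j \<and> r = 1" for j
      using column_row_eq_iff[of r 1] assms by simp
    ultimately have "(u, 2*i+r) \<in> petersen_edges n 1 \<longleftrightarrow>
      (\<exists>j<n. \<exists>s<2. u = 2*j+s \<and> (j = cyc_pred n i \<and> r = s \<or> s = 0 \<and> i = j \<and> r = 1))"
      unfolding petersen_edges_prism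
      by (simp add: column_row_eq_iff assms del: One_nat_def cong: conj_cong)
    also have "\<dots> \<longleftrightarrow> u = 2 * cyc_pred n i + r \<or> r = 1 \<and> u = 2*i"
      using assms cyc_pred_less[of i n] by auto
    finally show ?thesis .
  qed
  moreover have "r = 0 \<or> r = 1" using assms by auto
  ultimately show ?thesis
    unfolding open_nbhd_def by (auto simp: petersen_def simp del: One_nat_def)
qed

lemma sum_open_nbhd_prism:
  fixes f :: "nat \<Rightarrow> nat"
  assumes "n \<ge> 3" "i < n" "r < 2"
  shows "(\<Sum>u\<in>open_nbhd (petersen n 1) (2*i+r). f u) =
         f (2 * cyc_suc n i + r) + f (2 * cyc_pred n i + r) + f (2*i + (1-r))"
proof -
  have "cyc_suc n i \<noteq> cyc_pred n i" "cyc_suc n i \<noteq> i" "cyc_pred n i \<noteq> i"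
    using assms by (auto simp: cyc_suc_if cyc_pred_if split: if_splits)
  moreover have "2*j+r \<noteq> 2*i+(1-r)" for j using assms by arith
  ultimately show ?thesis
    unfolding open_nbhd_prism[OF assms] by simp
qed

lemma italian_dominating_prism:
  assumes "n \<ge> 3"
  shows "italian_dominating (petersen n 1) f \<longleftrightarrow>
     (\<forall>i<n. \<forall>r<2. f (2*i+r) \<le> 2 \<and> (f (2*i+r) = 0 \<longrightarrow>
        f (2 * cyc_suc n i + r) + f (2 * cyc_pred n i + r) + f (2*i + (1-r)) \<ge> 2))"
proof -
  have "x \<in> {0,1,2} \<longleftrightarrow> x \<le> 2" for x :: nat by auto
  then have range: "f ` A \<subseteq> {0,1,2} \<longleftrightarrow> (\<forall>v\<in>A. f v \<le> 2)" for A
    unfolding image_subset_iff by simp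
  have verts: "pverts (petersen n 1) = {0..<2*n}" by (simp add: petersen_def)
  show ?thesis
    unfolding italian_dominating_def range verts all_by_columns
    by (auto simp: sum_open_nbhd_prism[OF assms] simp del: One_nat_def)
qed

lemma weight_prism: "weight (petersen n 1) f = (\<Sum>i<n. f (2*i) + f (2*i+1))"
  using sum_by_columns by (simp add: weight_def petersen_def)

section \<open>The Italian domination number of the prism\<close>

text \<open>A vertex of value 0 sees a 1 in its own column, and another 1 in any neighbouring column whose
  1 lies in the opposite row to that of its own column.\<close>

lemma italian_dominating_zigzag:
  assumes "n \<ge> 3"
  shows "italian_dominating (petersen n 1) (\<lambda>v. if v mod 2 = v div 2 mod 2 then 1 else 0)"
proof -
  have "(\<lambda>v. if v mod 2 = v div 2 mod 2 then 1 else 0) (2*i+r) = (if r = i mod 2 then 1 else 0::nat)"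
    if "r < 2" for i r :: nat using that by simp
  note * = this[simplified]
  \<comment> \<open>At the seam of an odd cycle two neighbouring columns agree; there the other
      neighbouring column still lies in the opposite row, as \<open>n\<close> is at least 3.\<close>
  have seam: "even (cyc_suc n i) \<noteq> even i \<or> even (cyc_pred n i) \<noteq> even i" if "i < n" for i
  proof (cases "i + 1 = n")
    case True
    then have "cyc_pred n i = i - 1" "i > 0" using that assms by (auto simp: cyc_pred_if)
    then show ?thesis by simp
  next
    case False
    then show ?thesis using that by (simp add: cyc_suc_if)
  qed
  then show ?thesis
    unfolding italian_dominating_prism[OF assms]
    using seam by (auto simp: less_2_cases_iff * mod2_eq_if split: if_splits)
qed

lemma italian_domination_number_prism_le:
  assumes "n \<ge> 3"
  shows "italian_domination_number (petersen n 1) \<le> n"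
proof -
  let ?f = "\<lambda>v::nat. if v mod 2 = v div 2 mod 2 then 1 else 0::nat"
  have "weight (petersen n 1) ?f = (\<Sum>i<n. 1)"
    unfolding weight_prism by (intro sum.cong) (auto simp: mod2_eq_if)
  then show ?thesis
    unfolding italian_domination_number_def
    using italian_dominating_zigzag[OF assms] by (intro Least_le exI[of _ ?f]) simp
qed

text \<open>
  Discharging: a column of weight \<open>c\<close> sends \<open>h c / 2\<close> to each neighbouring column, where \<open>h c\<close> is
  the excess \<open>c - 1\<close> (0 for \<open>c = 0\<close>) capped at 2. A nonempty column keeps at least 1. An empty
  column receives at least 1, because its two neighbours have total weight at least 4 and hence
  capped excesses adding up to at least 2.
\<close>

lemma weight_ge_columns:
  assumes "n \<ge> 3" "italian_dominating (petersen n 1) f"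
  shows "n \<le> weight (petersen n 1) f"
proof -
  define c where "c i = f (2*i) + f (2*i+1)" for i
  define h :: "nat \<Rightarrow> nat" where "h x = min 2 (x - 1)" for x
  have local: "2 * c i + h (c (cyc_suc n i)) + h (c (cyc_pred n i)) \<ge> 2 + 2 * h (c i)"
    if i: "i < n" for i
  proof (cases "c i = 0")
    case True
    have dom: "f (2*i+r) = 0 \<longrightarrow>
        f (2 * cyc_suc n i + r) + f (2 * cyc_pred n i + r) + f (2*i + (1-r)) \<ge> 2" if "r < 2" for r
      using assms(2) i that unfolding italian_dominating_prism[OF assms(1)] by blast
    have "c (cyc_suc n i) + c (cyc_pred n i) \<ge> 4"
      using True dom[of 0] dom[of 1] by (simp add: c_def)
    then show ?thesis using True unfolding h_def by linarith
  next
    case False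
    then show ?thesis by (auto simp: h_def min_def)
  qed
  have "(\<Sum>i<n. 2 + 2 * h (c i)) \<le> (\<Sum>i<n. 2 * c i + h (c (cyc_suc n i)) + h (c (cyc_pred n i)))"
    by (intro sum_mono) (use local in auto)
  also have "\<dots> = 2 * (\<Sum>i<n. c i) + 2 * (\<Sum>i<n. h (c i))"
    by (simp add: sum.distrib sum_cyc_suc[of "\<lambda>i. h (c i)"]
        sum_cyc_pred[of "\<lambda>i. h (c i)"] flip: sum_distrib_left)
  finally have "n \<le> (\<Sum>i<n. c i)"
    by (simp only: sum.distrib sum_distrib_left[symmetric]) simp
  then show ?thesis by (simp only: weight_prism c_def)
qed

lemma italian_domination_number_prism:
  assumes "n \<ge> 3"
  shows "italian_domination_number (petersen n 1) = n"
  using italian_domination_number_prism_le[OF assms] weight_ge_columns[OF assms]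
    italian_domination_number_attained[of "petersen n 1"] by force

section \<open>Small dominating sets of the prism\<close>

lemma dominating_prism:
  assumes "n \<ge> 3"
  shows "dominating (petersen n 1) D \<longleftrightarrow> D \<subseteq> {0..<2*n} \<and>
     (\<forall>i<n. \<forall>r<2. 2*i+r \<in> D \<or> 2 * cyc_suc n i + r \<in> D \<or> 2 * cyc_pred n i + r \<in> D \<or> 2*i + (1-r) \<in> D)"
proof -
  have nbhd: "(\<exists>u\<in>D. v \<rightarrow>\<^bsub>petersen n 1\<^esub> u) \<longleftrightarrow> open_nbhd (petersen n 1) v \<inter> D \<noteq> {}" for v
    by (auto simp: open_nbhd_def)
  have verts: "pverts (petersen n 1) = {0..<2*n}" by (simp add: petersen_def)
  show ?thesis
    unfolding dominating_def nbhd verts all_by_columns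
    by (auto simp: open_nbhd_prism[OF assms] simp del: One_nat_def)
qed

text \<open>Vertices congruent to 0 modulo 8 lie in the columns with index divisible by 4, in the even row; those
  congruent to 5 lie halfway between them, in the odd row.\<close>

lemma domination_number_prism_le:
  assumes "n \<ge> 3" "n mod 4 = 0"
  shows "2 * domination_number (petersen n 1) \<le> n"
proof -
  obtain m where m: "n = 4 * m" using assms by auto
  define D where "D = (\<lambda>j. 8*j) ` {..<m} \<union> (\<lambda>j. 8*j+5) ` {..<m}"
  have mem: "v \<in> D \<longleftrightarrow> v < 2*n \<and> (v mod 8 = 0 \<or> v mod 8 = 5)" for v
  proof
    assume v: "v < 2*n \<and> (v mod 8 = 0 \<or> v mod 8 = 5)"
    then have "v div 8 < m" using m by auto
    moreover have "v = 8 * (v div 8) \<or> v = 8 * (v div 8) + 5" using v by presburger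
    ultimately
    show "v \<in> D" unfolding D_def by blast
  qed (auto simp: D_def m)
  have "2*i+r \<in> D \<or> 2 * cyc_suc n i + r \<in> D \<or> 2 * cyc_pred n i + r \<in> D \<or> 2*i + (1-r) \<in> D"
    if "i < n" "r < 2" for i r
  proof -
    have s: "cyc_suc n i < n" "cyc_suc n i mod 4 = (i mod 4 + 1) mod 4"
      using that m by (auto simp: cyc_suc_if mod_simps)
    have p: "cyc_pred n i < n" "cyc_pred n i mod 4 = (i mod 4 + 3) mod 4"
    proof -
      have "(cyc_pred n i + 4) mod 4 = (i + 3) mod 4"
      proof (cases "i = 0")
        case True
        then have "cyc_pred n i + 4 = (i + 3) + m * 4" using that m by (simp add: cyc_pred_if)
        then show ?thesis by (simp only: mod_mult_self1)
      next
        case False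
        then have "cyc_pred n i + 4 = i + 3" using that by (simp add: cyc_pred_if)
        then show ?thesis by (simp only:)
      qed
      then show "cyc_pred n i mod 4 = (i mod 4 + 3) mod 4" by (simp add: mod_simps)
    qed (use that cyc_pred_less in simp)
    have in_D: "2*k+t \<in> D \<longleftrightarrow> k mod 4 = 0 \<and> t = 0 \<or> k mod 4 = 2 \<and> t = 1"
      if "k < n" "t < 2" for k t
    proof -
      define q l where "q = k div 4" and "l = k mod 4"
      have k: "k = 4*q+l" "l < 4" by (auto simp: q_def l_def)
      then have "2*k+t = 2*l+t + 8*q" by simp
      then have "(2*k+t) mod 8 = (2*l+t) mod 8" by (simp only: mod_mult_self2)
      also have "\<dots> = 2*l+t" using k(2) that by simp
      finally have "2*k+t \<in> D \<longleftrightarrow> 2*l+t = 0 \<or> 2*l+t = 5"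
        unfolding mem using that by simp
      then show ?thesis unfolding l_def[symmetric] using k(2) that by arith
    qed
    have even_row: "2*k \<in> D \<longleftrightarrow> k mod 4 = 0" if "k < n" for k
      using in_D[of k 0] that by simp
    have odd_row: "Suc (2*k) \<in> D \<longleftrightarrow> k mod 4 = 2" if "k < n" for k
      using in_D[of k 1] that by simp
    have "i mod 4 < 4" by simp
    then have "i mod 4 = 0 \<or> i mod 4 = 1 \<or> i mod 4 = 2 \<or> i mod 4 = 3" by arith
    moreover have "r = 0 \<or> r = 1" using that by auto
    ultimately show ?thesis
      using that(1) s p by (elim disjE) (simp_all add: even_row odd_row)
  qed
  moreover have "D \<subseteq> {0..<2*n}" by (simp add: mem subset_iff)
  ultimately have "dominating (petersen n 1) D"
    unfolding dominating_prism[OF assms(1)] by simp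
  then have "domination_number (petersen n 1) \<le> card D"
    unfolding domination_number_def by (intro Least_le) blast
  also have "\<dots> \<le> m + m"
    unfolding D_def by (intro order.trans[OF card_Un_le] add_mono order.trans[OF card_image_le]) auto
  finally show ?thesis using m by simp
qed

text \<open>For \<open>n \<ge> 3\<close> the four vertices are distinct and form the closed neighbourhood of \<open>2*i+r\<close>, so
  this is the number of elements of \<open>D\<close> that dominate it.\<close>

definition dom_count :: "nat \<Rightarrow> nat set \<Rightarrow> nat \<Rightarrow> nat \<Rightarrow> nat" where
  "dom_count n D i r = of_bool (2*i+r \<in> D) + of_bool (2 * cyc_suc n i + r \<in> D)
     + of_bool (2 * cyc_pred n i + r \<in> D) + of_bool (2*i + (1-r) \<in> D)"

text \<open>Double counting: every chosen vertex contributes 4 to the sum of all \<open>2 * n\<close> counts, each of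
  which is at least 1.\<close>

lemma perfect_if_small:
  assumes "n \<ge> 3" "dominating (petersen n 1) D" "2 * card D \<le> n" "i < n" "r < 2"
  shows "dom_count n D i r = 1"
proof -
  define x :: "nat \<Rightarrow> nat" where "x v = of_bool (v \<in> D)" for v
  have sub: "D \<subseteq> {0..<2*n}" using assms dominating_prism by blast
  then have "card D = (\<Sum>v\<in>{0..<2*n}. x v)"
    by (simp add: x_def of_bool_def sum.If_cases Int_absorb1)
  then have cD: "card D = (\<Sum>i<n. x (2*i)) + (\<Sum>i<n. x (2*i+1))"
    by (simp only: sum_by_columns sum.distrib)
  let ?t = "\<lambda>i. dom_count n D i 0 + dom_count n D i 1"
  have ge: "dom_count n D j s \<ge> 1" if "j < n" "s < 2" for j s
  proof -
    have "2*j+s \<in> D \<or> 2 * cyc_suc n j + s \<in> D \<or> 2 * cyc_pred n j + s \<in> D \<or> 2*j + (1-s) \<in> D"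
      using assms(2) that unfolding dominating_prism[OF assms(1)] by blast
    then show ?thesis by (auto simp: dom_count_def)
  qed
  have "(\<Sum>j<n. ?t j) = 4 * card D"
    unfolding cD dom_count_def x_def[symmetric]
    using sum_cyc_suc[of "\<lambda>j. x (2*j)" n] sum_cyc_suc[of "\<lambda>j. x (2*j+1)" n]
      sum_cyc_pred[of "\<lambda>j. x (2*j)" n] sum_cyc_pred[of "\<lambda>j. x (2*j+1)" n]
    by (simp add: sum.distrib)
  then have "(\<Sum>j<n. ?t j) \<le> (\<Sum>j<n. 2)" using assms(3) by simp
  moreover have "(\<Sum>j<n. 2) < (\<Sum>j<n. ?t j)" if "?t i > 2"
  proof (rule sum_strict_mono_ex1)
    show "\<forall>j\<in>{..<n}. 2 \<le> ?t j" using ge[of _ 0] ge[of _ 1] by fastforce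
  qed (use that assms(4) in auto)
  ultimately have "?t i \<le> 2" by force
  then show ?thesis
    using ge[OF assms(4), of 0] ge[OF assms(4), of 1] assms(5) by (auto simp: less_2_cases_iff)
qed

text \<open>The vertex opposite to a chosen one in the next column is dominated neither from its own
  column nor from the previous one, since that would dominate some vertex twice. Its dominator
  therefore lies one column further on.\<close>

lemma perfect_step:
  assumes perfect: "\<And>i r. i < n \<Longrightarrow> r < 2 \<Longrightarrow> dom_count n D i r = 1"
    and "i < n" "r < 2" "2*i+r \<in> D"
  shows "2 * cyc_suc n (cyc_suc n i) + (1-r) \<in> D"
proof -
  let ?j = "cyc_suc n i"
  have j: "?j < n" "cyc_pred n ?j = i" using assms cyc_suc_less cyc_pred_suc by auto
  have 1: "2*i+(1-r) \<notin> D" "2*?j+r \<notin> D"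
    using perfect[OF assms(2,3)] assms(4) by (auto simp: dom_count_def)
  have 2: "2*?j+(1-r) \<notin> D"
    using perfect[OF j(1) assms(3)] assms(4) j(2) by (auto simp: dom_count_def)
  have "r = 0 \<or> r = 1" using assms(3) by auto
  then show ?thesis
    using perfect[OF j(1), of "1-r"] 1 2 j(2)
    by (elim disjE) (simp_all add: dom_count_def del: One_nat_def)
qed

lemma perfect_iterate:
  assumes perfect: "\<And>i r. i < n \<Longrightarrow> r < 2 \<Longrightarrow> dom_count n D i r = 1"
    and "i < n" "r < 2" "2*i+r \<in> D"
  shows "2 * ((i + 2*k) mod n) + (if even k then r else 1-r) \<in> D"
proof (induction k)
  case (Suc k)
  have "cyc_suc n (cyc_suc n ((i + 2*k) mod n)) = (i + 2 * Suc k) mod n"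
    by (simp add: cyc_suc_def mod_simps)
  moreover have "1 - (if even k then r else 1-r) = (if even (Suc k) then r else 1-r)"
    using assms by auto
  moreover have "2 * cyc_suc n (cyc_suc n ((i + 2*k) mod n)) + (1 - (if even k then r else 1-r)) \<in> D"
    using assms(2,3) by (intro perfect_step[OF perfect _ _ Suc.IH]) auto
  ultimately show ?case by (simp only:)
qed (use assms in simp)

text \<open>If 4 does not divide \<open>n\<close>, an odd number of steps of length 2 leads back to the starting
  column: \<open>n\<close> steps for odd \<open>n\<close>, otherwise \<open>n div 2\<close>. Both vertices of that column are then chosen,
  and each is dominated twice.\<close>

lemma small_dominating_imp_dvd:
  assumes "n \<ge> 3" "dominating (petersen n 1) D" "2 * card D \<le> n"
  shows "n mod 4 = 0"
proof (rule ccontr)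
  assume "n mod 4 \<noteq> 0"
  define k where "k = (if odd n then n else n div 2)"
  have k: "odd k" "2 * k mod n = 0"
    using \<open>n mod 4 \<noteq> 0\<close> by (auto simp: k_def)
  have perfect: "dom_count n D i r = 1" if "i < n" "r < 2" for i r
    using perfect_if_small[OF assms that] .
  have "D \<noteq> {}" using perfect[of 0 0] assms(1) by (auto simp: dom_count_def)
  then obtain v where v: "v \<in> D" "v < 2*n"
    using assms dominating_prism by fastforce
  define i r where "i = v div 2" and "r = v mod 2"
  have ir: "i < n" "r < 2" "2*i+r \<in> D" using v by (auto simp: i_def r_def)
  have "(i + 2*k) mod n = i" using k(2) ir(1) by (metis add.right_neutral mod_add_right_eq mod_less)
  then have "2*i+(1-r) \<in> D" using perfect_iterate[OF perfect ir, of k] k(1) by simp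
  then show False using perfect[OF ir(1,2)] ir(3) by (simp add: dom_count_def)
qed

section \<open>The classification\<close>

theorem mainTheorem6:
  fixes n :: nat
  assumes "n \<ge> 3"
  shows "(n mod 4 = 0 \<longrightarrow> italian_graph (petersen n 1)) \<and>
         (n mod 4 \<noteq> 0 \<longrightarrow> \<not> italian_graph (petersen n 1))"
proof -
  have "n \<le> 2 * domination_number (petersen n 1)"
    using italian_domination_number_le_double[OF pair_graph_petersen[of n 1]]
      italian_domination_number_prism[OF assms] assms by simp
  moreover have "n mod 4 = 0" if "2 * domination_number (petersen n 1) = n"
    using that small_dominating_imp_dvd[OF assms] domination_number_attained[of "petersen n 1"]
    by auto
  ultimately show ?thesis
    unfolding italian_graph_def italian_domination_number_prism[OF assms]
    using domination_number_prism_le[OF assms] by fastforce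
qed

end
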